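(* Fix scalars $\rho$ and $u_0$, with $0 < \rho \leq \infty$ and $u_0 \in (0,1)$. Given a function $F : [0,\rho) \to \mathbb{R}$, the following are equivalent. (1) The map $F[-]$ sends $\mathcal{M}^\rho(\{1,u_0\}) \cup \mathcal{M}^\rho(\{0,1\})$ into $\mathcal{M}(\mathbb{R})$, and $F(a)F(b) \geq F(\sqrt{ab})^2$ for all $a, b \in [0,\rho)$. (2) The map $F[-]$ sends $\mathcal{M}^\rho([0,1])$ into $\mathcal{M}([0,1])$. (3) The function $F$ agrees on $(0,\rho)$ with an absolutely monotonic entire function and $0 \leq F(0) \leq \lim_{\epsilon \to 0^+} F(\epsilon)$. If $F$ is known to be continuous on $(0,\rho)$, then the second hypothesis in (1) (namely, that $F(a)F(b) \geq F(\sqrt{ab})^2$ for all $a,b \in [0,\rho)$) may be omitted.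
   Context: An admissible measure is a non-negative measure $\mu$ on $\mathbb{R}$ possessing moments of all orders; its moments are $s_k(\mu) := \int_{\mathbb{R}} x^k \, d\mu$ ($k \geq 0$), where $s_0(\mu)$ is the total mass. For $K \subset \mathbb{R}$, $\mathcal{M}(K)$ denotes the set of moment sequences $(s_k(\mu))_{k \geq 0}$ of admissible measures $\mu$ supported on $K$, and $\mathcal{M}^\rho(K)$ is the subset of those sequences all of whose terms lie in $(-\rho,\rho)$ (so $\mathcal{M}^\infty(K) = \mathcal{M}(K)$). A function $F$ acts entrywise on a sequence by $F[(s_k)_{k\geq 0}] := (F(s_k))_{k \geq 0}$. An absolutely monotonic entire function is an entire function with non-negative Taylor coefficients at every point of $(0,\infty)$; equivalently, an entire function with non-negative Taylor coefficients at zero.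
   Formalization: For finite ρ, "entire" in (3) is replaced by analytic on the disc |z|<ρ with non-negative Taylor coefficients at points of (0,ρ), since as stated F(x)=1/(ρ−x) satisfies (2) but agrees with no entire function; for ρ=∞ nothing is changed. *)

theory Defs
  imports "HOL-Complex_Analysis.Complex_Analysis"
begin

text \<open>Integrability for exponent 0 makes the measure finite; non-negativity is built into
  the type of measures.\<close>

definition admissible_measure :: "real measure \<Rightarrow> bool" where
  "admissible_measure M \<longleftrightarrow> sets M = sets borel \<and> (\<forall>k::nat. integrable M (\<lambda>x. x ^ k))"

definition moment :: "real measure \<Rightarrow> nat \<Rightarrow> real" where
  "moment M k = (\<integral>x. x ^ k \<partial>M)"

text \<open>For closed \<open>K\<close> (the only case used), the measure is supported on \<open>K\<close> iff the complement of
  \<open>K\<close> is a null set.\<close>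

definition moment_seqs :: "real set \<Rightarrow> (nat \<Rightarrow> real) set" where
  "moment_seqs K = {moment M | M. admissible_measure M \<and> (AE x in M. x \<in> K)}"

definition moment_seqs_lt :: "ereal \<Rightarrow> real set \<Rightarrow> (nat \<Rightarrow> real) set" where
  "moment_seqs_lt \<rho> K = {s \<in> moment_seqs K. \<forall>k. - \<rho> < ereal (s k) \<and> ereal (s k) < \<rho>}"

lemma moment_seqs_lt_infinity: "moment_seqs_lt \<infinity> K = moment_seqs K"
  by (simp add: moment_seqs_lt_def)

definition entrywise_sends ::
    "(real \<Rightarrow> real) \<Rightarrow> (nat \<Rightarrow> real) set \<Rightarrow> (nat \<Rightarrow> real) set \<Rightarrow> bool" where
  "entrywise_sends F A B \<longleftrightarrow> (\<forall>s\<in>A. (\<lambda>k. F (s k)) \<in> B)"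

text \<open>For \<open>\<rho> = \<infinity>\<close> this is an absolutely monotonic entire function: see the lemma below.
  For finite \<open>\<rho>\<close>, analyticity is required on the disc of radius \<open>\<rho>\<close> only, and the Taylor
  coefficients are taken at the points of \<open>(0,\<rho>)\<close>. Literal entireness would be too strong there:
  the function \<open>1 / (\<rho> - x)\<close> maps moment sequences of measures on \<open>[0,1]\<close> with terms below \<open>\<rho>\<close>
  to moment sequences of measures on \<open>[0,1]\<close>, but blows up at \<open>\<rho>\<close>.\<close>

definition abs_monotonic_entire :: "ereal \<Rightarrow> (complex \<Rightarrow> complex) \<Rightarrow> bool" where
  "abs_monotonic_entire \<rho> g \<longleftrightarrow>
     g holomorphic_on {z. ereal (norm z) < \<rho>} \<and>
     (\<forall>x::real. 0 < x \<and> ereal x < \<rho> \<longrightarrow>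
        (\<forall>n. (deriv ^^ n) g (of_real x) / fact n \<in> \<real>\<^sub>\<ge>\<^sub>0))"

lemma abs_monotonic_entire_infinity:
  "abs_monotonic_entire \<infinity> g \<longleftrightarrow>
     g holomorphic_on UNIV \<and>
     (\<forall>x::real. 0 < x \<longrightarrow> (\<forall>n. (deriv ^^ n) g (of_real x) / fact n \<in> \<real>\<^sub>\<ge>\<^sub>0))"
  by (simp add: abs_monotonic_entire_def)

end

theory Submission
  imports Defs "HOL-Probability.Giry_Monad"
begin

text \<open>The implications run from (1) to (3) to (2) to (1); continuity of \<open>F\<close> is the only thing that
  the second half of (1) contributes to the first step.

  From (1) to (3). Measures on \<open>{0,1}\<close> show that \<open>F\<close> is nonnegative and nondecreasing, and a
  nondecreasing function with \<open>F (sqrt (a * b))\<^sup>2 \<le> F a * F b\<close> has no jumps in \<open>(0,\<rho>)\<close>. A measure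
  with masses \<open>a\<close> at \<open>1\<close> and \<open>b\<close> at \<open>u0\<close> gives \<open>\<Sum>k. c k * F (a + b * u0 ^ k) \<ge> 0\<close> whenever the
  polynomial with coefficients \<open>c\<close> is nonnegative on the line. For smooth \<open>F\<close>, the polynomial
  \<open>(\<Prod>j<n. X - u0 ^ j)\<^sup>2\<close> and \<open>b\<close> tending to \<open>0\<close> isolate the \<open>n\<close>-th Taylor coefficient, so that all
  derivatives of \<open>F\<close> are nonnegative. For continuous \<open>F\<close>, the same computation applied to
  \<open>n\<close>-th differences of \<open>n\<close>-th antiderivatives shows that all forward differences of \<open>F\<close> are
  nonnegative (\<open>fdiff_pow_nonneg\<close>). These differences are the coefficients of the Bernstein polynomials
  of \<open>F\<close> in the monomial basis (\<open>Bernstein_Newton_form\<close>), so \<open>F\<close> is a limit of polynomials with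
  nonnegative coefficients, and Montel's theorem upgrades the convergence to the complex disc
  (\<open>abs_monotonic_entire_limit\<close>).

  From (3) to (2). On \<open>(0,\<rho>)\<close> the function is a power series with nonnegative coefficients, and moment
  sequences on \<open>[0,1]\<close> are closed under products, by multiplicative convolution, and under
  mixtures (\<open>moment_seqs_unit_mult\<close>, \<open>moment_seqs_unit_mixture\<close>). The inequality
  \<open>F 0 \<le> lim F\<close> takes care of measures concentrated at \<open>0\<close>.

  From (2) to (1). The multiplicative convexity of \<open>F\<close> is the Cauchy-Schwarz inequality for the
  transform of a single point mass.\<close>

section \<open>Moment sequences and their test polynomials\<close>

lemma moment_seqs_mono: "K \<subseteq> K' \<Longrightarrow> moment_seqs K \<subseteq> moment_seqs K'"
  unfolding moment_seqs_def by (blast intro: eventually_mono)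

lemma moment_seqs_lt_mono: "K \<subseteq> K' \<Longrightarrow> moment_seqs_lt \<rho> K \<subseteq> moment_seqs_lt \<rho> K'"
  using moment_seqs_mono unfolding moment_seqs_lt_def by blast

lemma entrywise_sends_mono:
  "entrywise_sends F A B \<Longrightarrow> A' \<subseteq> A \<Longrightarrow> B \<subseteq> B' \<Longrightarrow> entrywise_sends F A' B'"
  unfolding entrywise_sends_def by blast

lemma finite_atomic_moment_seq:
  fixes w :: "real \<Rightarrow> real"
  assumes "finite A" and w: "\<And>x. x \<in> A \<Longrightarrow> 0 \<le> w x"
  shows "(\<lambda>k. \<Sum>x\<in>A. w x * x ^ k) \<in> moment_seqs A"
proof -
  let ?M = "distr (point_measure A w) borel (\<lambda>x. x)"
  have m: "(\<lambda>x. x) \<in> measurable (point_measure A w) borel"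
    by (simp add: measurable_point_measure_eq1)
  have int: "integrable ?M (\<lambda>x. x ^ k)" for k :: nat
    using assms by (simp add: integrable_distr_eq[OF m] integrable_point_measure_finite)
  have mom: "moment ?M = (\<lambda>k. \<Sum>x\<in>A. w x * x ^ k)"
    using assms by (simp add: fun_eq_iff moment_def integral_distr[OF m]
        lebesgue_integral_point_measure_finite)
  have "AE x in ?M. x \<in> A"
    by (subst AE_distr_iff[OF m])
       (use \<open>finite A\<close> in \<open>auto simp: point_measure_def AE_density AE_count_space finite_imp_closed\<close>)
  then show ?thesis
    unfolding moment_seqs_def admissible_measure_def mom[symmetric] using int by fastforce
qed

text \<open>Powers of a point of \<open>[0,1]\<close> are at most \<open>1\<close>, so the total mass is the largest moment
  and is the only one that has to be compared with \<open>\<rho>\<close>.\<close>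

lemma two_atom_moment_seq_lt:
  assumes "0 < \<rho>" "x \<noteq> y" "x \<in> {0..1}" "y \<in> {0..1}" "0 \<le> a" "0 \<le> b" "ereal (a + b) < \<rho>"
  shows "(\<lambda>k. a * x ^ k + b * y ^ k) \<in> moment_seqs_lt \<rho> {x, y}"
proof -
  have "(\<lambda>k. \<Sum>z\<in>{x, y}. (if z = x then a else b) * z ^ k) \<in> moment_seqs {x, y}"
    by (rule finite_atomic_moment_seq) (use assms in auto)
  then have "(\<lambda>k. a * x ^ k + b * y ^ k) \<in> moment_seqs {x, y}"
    using \<open>x \<noteq> y\<close> by simp
  moreover have "- \<rho> < ereal (a * x ^ k + b * y ^ k) \<and> ereal (a * x ^ k + b * y ^ k) < \<rho>" for k
  proof -
    have "0 \<le> a * x ^ k + b * y ^ k"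
      using assms by simp
    moreover have "a * x ^ k + b * y ^ k \<le> a + b"
      using assms by (intro add_mono mult_left_le power_le_one) auto
    moreover have "- \<rho> < 0"
      using \<open>0 < \<rho>\<close> by (simp add: ereal_uminus_less_reorder)
    ultimately show ?thesis
      using \<open>ereal (a + b) < \<rho>\<close> by (meson ereal_less_eq(3) ereal_less_eq(5) le_less_trans less_le_trans)
  qed
  ultimately show ?thesis
    unfolding moment_seqs_lt_def by simp
qed

text \<open>The integral of \<open>p\<close> against the representing measure. All information about
  the transformed sequences is extracted through this inequality, for polynomials \<open>p\<close> that are squares.\<close>

lemma moment_seqs_poly_nonneg:
  assumes "s \<in> moment_seqs UNIV" and "\<And>x. 0 \<le> poly p x"
  shows "0 \<le> (\<Sum>k\<le>degree p. coeff p k * s k)"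
proof -
  obtain M where M: "\<And>k::nat. integrable M (\<lambda>x. x ^ k)" "s = moment M"
    using assms(1) unfolding moment_seqs_def admissible_measure_def by auto
  have "(\<Sum>k\<le>degree p. coeff p k * s k) = (\<integral>x. poly p x \<partial>M)"
    using M(1) by (simp add: M(2) moment_def poly_altdef)
  then show ?thesis
    using assms(2) by simp
qed

lemma moment_seqs_Cauchy_Schwarz:
  assumes "s \<in> moment_seqs UNIV"
  shows "(s 1)\<^sup>2 \<le> s 0 * s 2"
proof -
  have quad: "0 \<le> t\<^sup>2 * s 0 - 2 * t * s 1 + s 2" for t
  proof -
    \<comment> \<open>The test polynomial is \<open>(x - t)\<^sup>2\<close>.\<close>
    have "0 \<le> (\<Sum>k\<le>degree ([:-t,1:]^2). coeff ([:-t,1:]^2) k * s k)"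
      by (rule moment_seqs_poly_nonneg[OF assms]) simp
    then show ?thesis
      by (simp add: power2_eq_square numeral_2_eq_2 algebra_simps)
  qed
  have "0 \<le> (\<Sum>k\<le>degree [:1::real:]. coeff [:1:] k * s k)"
    by (rule moment_seqs_poly_nonneg[OF assms]) simp
  then have s0: "0 \<le> s 0" by simp
  show ?thesis
  proof (cases "s 0 = 0")
    case True
    \<comment> \<open>Otherwise the quadratic in \<open>t\<close> is affine with nonzero slope and takes the value \<open>-1\<close>.\<close>
    have "s 1 = 0"
    proof (rule ccontr)
      assume "s 1 \<noteq> 0"
      then have "2 * ((s 2 + 1) / (2 * s 1)) * s 1 = s 2 + 1"
        by simp
      then show False
        using True quad[of "(s 2 + 1) / (2 * s 1)"] by simp
    qed
    then show ?thesis
      using True by simp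
  next
    case False
    with s0 quad[of "s 1 / s 0"] show ?thesis
      by (simp add: field_simps power2_eq_square)
  qed
qed

section \<open>Moment sequences on the unit interval\<close>

text \<open>Over \<open>[0,1]\<close> all powers are nonnegative and bounded, so the moments can be computed by
  nonnegative integrals, where Fubini and countable mixtures come without integrability conditions;
  that the values are finite is what makes the measure admissible.\<close>

lemma moment_seqs_unit_iff:
  "s \<in> moment_seqs {0..1} \<longleftrightarrow>
    (\<exists>M. sets M = sets borel \<and> (AE x in M. x \<in> {0..1}) \<and>
      (\<forall>k. 0 \<le> s k \<and> (\<integral>\<^sup>+x. ennreal (x ^ k) \<partial>M) = ennreal (s k)))"
proof -
  have eq: "(admissible_measure M \<and> s = moment M) \<longleftrightarrow>
      (\<forall>k. 0 \<le> s k \<and> (\<integral>\<^sup>+x. ennreal (x ^ k) \<partial>M) = ennreal (s k))"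
    if sets: "sets M = sets borel" and supp: "AE x in M. x \<in> {0..1}" for M
  proof -
    have [measurable_cong]: "sets M = sets borel"
      by fact
    have pos: "AE x in M. 0 \<le> x ^ k" for k
      using supp by eventually_elim simp
    have meas: "(\<lambda>x. x ^ k) \<in> borel_measurable M" for k
      by measurable
    have "(integrable M (\<lambda>x. x ^ k) \<and> s k = moment M k) \<longleftrightarrow>
        (0 \<le> s k \<and> (\<integral>\<^sup>+x. ennreal (x ^ k) \<partial>M) = ennreal (s k))" for k
      using nn_integral_eq_integrable[OF meas pos, of "s k" k] integral_nonneg_AE[OF pos, of k]
      unfolding moment_def by auto
    then show ?thesis
      unfolding admissible_measure_def fun_eq_iff using sets by blast
  qed
  show ?thesis
  proof
    assume "s \<in> moment_seqs {0..1}"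
    then show "\<exists>M. sets M = sets borel \<and> (AE x in M. x \<in> {0..1}) \<and>
        (\<forall>k. 0 \<le> s k \<and> (\<integral>\<^sup>+x. ennreal (x ^ k) \<partial>M) = ennreal (s k))"
      unfolding moment_seqs_def using eq by (auto simp only: admissible_measure_def mem_Collect_eq) blast
  next
    assume "\<exists>M. sets M = sets borel \<and> (AE x in M. x \<in> {0..1}) \<and>
        (\<forall>k. 0 \<le> s k \<and> (\<integral>\<^sup>+x. ennreal (x ^ k) \<partial>M) = ennreal (s k))"
    then show "s \<in> moment_seqs {0..1}"
      unfolding moment_seqs_def using eq by blast
  qed
qed

text \<open>The product sequence belongs to the multiplicative convolution: the distribution of \<open>xy\<close>
  when \<open>(x,y)\<close> is distributed according to the product of the two measures.\<close>

lemma moment_seqs_unit_mult: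
  assumes "s \<in> moment_seqs {0..1}" "t \<in> moment_seqs {0..1}"
  shows "(\<lambda>k. s k * t k) \<in> moment_seqs {0..1}"
proof -
  obtain M N where [measurable_cong]: "sets M = sets borel" "sets N = sets borel"
    and supp: "AE x in M. x \<in> {0..1}" "AE x in N. x \<in> {0..1}"
    and pos: "\<And>k. 0 \<le> s k" "\<And>k. 0 \<le> t k"
    and mom: "\<And>k. (\<integral>\<^sup>+x. ennreal (x ^ k) \<partial>M) = ennreal (s k)"
       "\<And>k. (\<integral>\<^sup>+x. ennreal (x ^ k) \<partial>N) = ennreal (t k)"
    using assms unfolding moment_seqs_unit_iff by metis
  interpret M: finite_measure M
    using mom(1)[of 0] by (intro finite_measureI) simp
  interpret N: finite_measure N
    using mom(2)[of 0] by (intro finite_measureI) simp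
  interpret P: pair_sigma_finite M N ..
  let ?Q = "distr (M \<Otimes>\<^sub>M N) borel (\<lambda>z. fst z * snd z)"
  have "AE z in M \<Otimes>\<^sub>M N. fst z * snd z \<in> {0..1}"
  proof (rule P.AE_pair_measure)
    show "AE x in M. AE y in N. fst (x, y) * snd (x, y) \<in> {0..1}"
      using supp(1)
    proof eventually_elim
      case (elim x)
      show ?case
        using supp(2) by eventually_elim (use elim in \<open>auto intro: mult_le_one\<close>)
    qed
  qed measurable
  then have "AE x in ?Q. x \<in> {0..1}"
    by (subst AE_distr_iff) auto
  moreover have "(\<integral>\<^sup>+x. ennreal (x ^ k) \<partial>?Q) = ennreal (s k * t k)" for k
  proof -
    have "(\<integral>\<^sup>+x. ennreal (x ^ k) \<partial>?Q) = (\<integral>\<^sup>+x. \<integral>\<^sup>+y. ennreal ((x * y) ^ k) \<partial>N \<partial>M)"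
      by (simp add: nn_integral_distr N.nn_integral_fst[symmetric])
    also have "\<dots> = (\<integral>\<^sup>+x. ennreal (x ^ k) * ennreal (t k) \<partial>M)"
      using supp(1)
    proof (intro nn_integral_cong_AE, eventually_elim)
      case (elim x)
      have "(\<integral>\<^sup>+y. ennreal ((x * y) ^ k) \<partial>N) = (\<integral>\<^sup>+y. ennreal (x ^ k) * ennreal (y ^ k) \<partial>N)"
        using supp(2)
        by (intro nn_integral_cong_AE, eventually_elim)
           (use elim in \<open>simp add: power_mult_distrib ennreal_mult\<close>)
      then show ?case
        by (simp add: nn_integral_cmult mom)
    qed
    also have "\<dots> = ennreal (s k * t k)"
      by (simp add: nn_integral_multc mom ennreal_mult pos)
    finally show ?thesis .
  qed
  ultimately show ?thesis
    unfolding moment_seqs_unit_iff using pos by (intro exI[of _ ?Q]) simp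
qed

lemma moment_seqs_unit_cmult:
  assumes "s \<in> moment_seqs {0..1}" "0 \<le> c"
  shows "(\<lambda>k. c * s k) \<in> moment_seqs {0..1}"
proof -
  have "(\<lambda>k. \<Sum>x\<in>{1::real}. c * x ^ k) \<in> moment_seqs {0..1}"
    by (rule subsetD[OF moment_seqs_mono finite_atomic_moment_seq]) (use assms in auto)
  from moment_seqs_unit_mult[OF this assms(1)] show ?thesis
    by simp
qed

lemma moment_seqs_unit_power:
  assumes "s \<in> moment_seqs {0..1}"
  shows "(\<lambda>k. s k ^ j) \<in> moment_seqs {0..1}"
proof (induction j)
  case 0
  have "(\<lambda>k. \<Sum>x\<in>{1::real}. 1 * x ^ k) \<in> moment_seqs {0..1}"
    by (rule subsetD[OF moment_seqs_mono finite_atomic_moment_seq]) auto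
  then show ?case by simp
next
  case (Suc j)
  then show ?case
    using moment_seqs_unit_mult[OF assms] by simp
qed

text \<open>The representing measure is the sum of the measures of \<open>s j\<close> with weights \<open>w j\<close>. It is
  obtained as the monadic bind of the weighted counting measure on the indices with the kernel formed
  by these measures; the kernel has to consist of subprobability measures, hence the bound on the
  masses \<open>s j 0\<close>.\<close>

lemma moment_seqs_unit_mixture:
  fixes w :: "nat \<Rightarrow> real"
  assumes s: "\<And>j. s j \<in> moment_seqs {0..1}" "\<And>j. s j 0 \<le> 1"
    and w: "\<And>j. 0 \<le> w j" and sums: "\<And>k. (\<lambda>j. w j * s j k) sums r k"
  shows "r \<in> moment_seqs {0..1}"
proof -
  have "\<forall>j. \<exists>M. sets M = sets borel \<and> (AE x in M. x \<in> {0..1}) \<and>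
      (\<forall>k. 0 \<le> s j k \<and> (\<integral>\<^sup>+x. ennreal (x ^ k) \<partial>M) = ennreal (s j k))"
    using s(1) unfolding moment_seqs_unit_iff by blast
  then obtain K where K: "\<And>j. sets (K j) = sets borel" "\<And>j. AE x in K j. x \<in> {0..1}"
    "\<And>j k. 0 \<le> s j k" "\<And>j k. (\<integral>\<^sup>+x. ennreal (x ^ k) \<partial>K j) = ennreal (s j k)"
    by metis
  define D where "D = density (count_space UNIV) (\<lambda>j. ennreal (w j))"
  have spK: "space (K j) = UNIV" for j
    using sets_eq_imp_space_eq[OF K(1)] by simp
  have "subprob_space (K j)" for j
    using K(4)[of j 0] s(2)[of j] by (intro subprob_spaceI) (auto simp: spK)
  then have kernel: "K \<in> measurable D (subprob_algebra borel)"
    using K(1) by (auto simp: D_def space_subprob_algebra)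
  have int_bind: "(\<integral>\<^sup>+x. ennreal (x ^ k) \<partial>(D \<bind> K)) = ennreal (r k)" for k
  proof -
    have "(\<integral>\<^sup>+x. ennreal (x ^ k) \<partial>(D \<bind> K)) = (\<integral>\<^sup>+j. ennreal (s j k) \<partial>D)"
      by (subst nn_integral_bind[OF _ kernel]) (simp_all add: K)
    also have "\<dots> = (\<Sum>j. ennreal (w j * s j k))"
      by (simp add: D_def nn_integral_density nn_integral_count_space_nat ennreal_mult w K)
    also have "\<dots> = ennreal (r k)"
      using sums[of k] by (intro suminf_ennreal_eq) (simp_all add: w K)
    finally show ?thesis .
  qed
  have "AE x in D \<bind> K. x \<in> {0..1}"
    by (subst AE_bind[OF kernel]) (use K(2) in simp_all)
  moreover have "sets (D \<bind> K) = sets borel"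
    by (rule sets_bind_measurable[OF kernel]) (simp add: D_def)
  moreover have "0 \<le> r k" for k
    using sums_le[OF _ sums_zero sums[of k]] w K(3) by simp
  ultimately show ?thesis
    unfolding moment_seqs_unit_iff using int_bind by blast
qed

text \<open>One vanishing moment forces the measure to be concentrated at \<open>0\<close>.\<close>

lemma moment_seqs_unit_vanish:
  assumes "s \<in> moment_seqs {0..1}" "s k = 0" "0 < j"
  shows "s j = 0"
proof -
  obtain M where [measurable_cong]: "sets M = sets borel" and supp: "AE x in M. x \<in> {0..1}"
    and M: "\<And>k. 0 \<le> s k" "\<And>k. (\<integral>\<^sup>+x. ennreal (x ^ k) \<partial>M) = ennreal (s k)"
    using assms(1) unfolding moment_seqs_unit_iff by blast
  have "AE x in M. ennreal (x ^ k) = 0"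
    using M(2)[of k] \<open>s k = 0\<close> by (simp add: nn_integral_0_iff_AE)
  with supp have "AE x in M. ennreal (x ^ j) = 0"
  proof eventually_elim
    case (elim x)
    then have "x ^ k \<le> 0" "0 \<le> x ^ k"
      by (auto simp: ennreal_eq_0_iff)
    then have "x ^ k = 0"
      by (rule order_antisym)
    then have "x = 0"
      by simp
    with \<open>0 < j\<close> show ?case
      by simp
  qed
  then have "(\<integral>\<^sup>+x. ennreal (x ^ j) \<partial>M) = 0"
    by (subst nn_integral_0_iff_AE) auto
  with M show ?thesis
    by (metis ennreal_eq_0_iff order_antisym)
qed

section \<open>Forward differences and antiderivatives\<close>

definition fdiff :: "real \<Rightarrow> (real \<Rightarrow> real) \<Rightarrow> real \<Rightarrow> real" where
  "fdiff h f x = f (x + h) - f x"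

lemma fdiff_sum:
  "fdiff h (\<lambda>x. \<Sum>k\<in>A. c k * g k x) = (\<lambda>x. \<Sum>k\<in>A. c k * fdiff h (g k) x)"
  by (simp add: fun_eq_iff fdiff_def sum_subtractf right_diff_distrib)

lemma fdiff_pow_sum_shift:
  "(fdiff h ^^ n) (\<lambda>x. \<Sum>k\<in>A. c k * f (x + r k)) = (\<lambda>x. \<Sum>k\<in>A. c k * (fdiff h ^^ n) f (x + r k))"
proof (induction n)
  case (Suc n)
  have "fdiff h (\<lambda>x. (fdiff h ^^ n) f (x + r k)) x = fdiff h ((fdiff h ^^ n) f) (x + r k)" for k x
    by (simp add: fdiff_def algebra_simps)
  with Suc show ?case
    by (simp add: fdiff_sum)
qed simp

lemma DERIV_fdiff_pow:
  assumes "\<And>x. (f has_real_derivative f' x) (at x)"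
  shows "((fdiff h ^^ n) f has_real_derivative (fdiff h ^^ n) f' x) (at x)"
proof (induction n arbitrary: x)
  case (Suc n)
  have "((\<lambda>x. (fdiff h ^^ n) f (x + h) - (fdiff h ^^ n) f x) has_real_derivative
      (fdiff h ^^ n) f' (x + h) - (fdiff h ^^ n) f' x) (at x)"
    using Suc[of x] Suc[of "x + h"] by (intro DERIV_diff) (simp_all add: DERIV_shift)
  then show ?case
    by (simp add: fdiff_def[abs_def])
qed (use assms in auto)

lemma continuous_fdiff_pow:
  assumes "continuous_on UNIV f"
  shows "continuous_on UNIV ((fdiff h ^^ n) f)"
proof (induction n)
  case (Suc n)
  then have "continuous_on UNIV (\<lambda>x. (fdiff h ^^ n) f (x + h) - (fdiff h ^^ n) f x)"
    by (intro continuous_intros continuous_on_compose2[OF Suc]) auto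
  then show ?case
    by (simp add: fdiff_def[abs_def])
qed (use assms in simp)

text \<open>Repeated antiderivatives replace mollification: differences of the \<open>n\<close>-th antiderivative of
  \<open>f\<close> are \<open>n\<close> times differentiable, and their \<open>n\<close>-th derivative is the \<open>n\<close>-th difference of \<open>f\<close>.\<close>

lemma antiderivative_sequence:
  fixes f :: "real \<Rightarrow> real"
  assumes "continuous_on UNIV f"
  obtains J where "J 0 = f" "\<And>m x. (J (Suc m) has_real_derivative J m x) (at x)"
proof -
  have step: "\<exists>G. continuous_on UNIV G \<and> (\<forall>x. (G has_real_derivative g x) (at x))"
    if g: "continuous_on UNIV g" for g :: "real \<Rightarrow> real"
  proof -
    from g obtain G where G: "\<And>x. (G has_real_derivative g x) (at x)"
      using einterval_antiderivative[of "-\<infinity>" "\<infinity>" g]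
      by (auto simp: continuous_on_eq_continuous_at has_real_derivative_iff_has_vector_derivative)
    then have "continuous_on UNIV G"
      by (meson DERIV_isCont continuous_at_imp_continuous_on)
    with G show ?thesis by blast
  qed
  have "\<exists>J. \<forall>m. (continuous_on UNIV (J m) \<and> (m = 0 \<longrightarrow> J m = f)) \<and>
      (\<forall>x. (J (Suc m) has_real_derivative J m x) (at x))"
    using assms step
    by (intro dependent_nat_choice[where
          P = "\<lambda>m g. continuous_on UNIV g \<and> (m = 0 \<longrightarrow> g = f)" and
          Q = "\<lambda>m g G. \<forall>x. (G has_real_derivative g x) (at x)"]) auto
  then show ?thesis
    using that by metis
qed

text \<open>Up to a power of \<open>h\<close>, the left-hand side is an \<open>n\<close>-fold moving average of \<open>J 0\<close> over windows of
  length \<open>h\<close>, which is nonnegative where \<open>J 0\<close> is. In derivative form: a function with nonnegative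
  derivative has nonnegative first difference.\<close>

lemma fdiff_pow_antiderivative_nonneg:
  assumes J: "\<And>m x. (J (Suc m) has_real_derivative J m x) (at x)" and "0 \<le> h"
    and pos: "\<And>x. 0 \<le> x \<Longrightarrow> x < d \<Longrightarrow> 0 \<le> J 0 x"
    and "0 \<le> x" "x + real n * h < d"
  shows "0 \<le> (fdiff h ^^ n) (J n) x"
  using assms(4,5)
proof (induction n arbitrary: x)
  case (Suc n)
  have "(fdiff h ^^ n) (J (Suc n)) x \<le> (fdiff h ^^ n) (J (Suc n)) (x + h)"
  proof (rule DERIV_nonneg_imp_nondecreasing[where f = "(fdiff h ^^ n) (J (Suc n))"])
    fix y assume y: "x \<le> y" "y \<le> x + h"
    then have "0 \<le> (fdiff h ^^ n) (J n) y"
      using Suc by (intro Suc.IH) (auto simp: algebra_simps)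
    then show "\<exists>d. ((fdiff h ^^ n) (J (Suc n)) has_real_derivative d) (at y) \<and> 0 \<le> d"
      using DERIV_fdiff_pow[OF J] by blast
  qed (use \<open>0 \<le> h\<close> in simp)
  then show ?case
    by (simp add: fdiff_def[of h "(fdiff h ^^ n) (J (Suc n))"])
qed (use pos in simp)

text \<open>By Taylor's formula \<open>D 0 b\<close> behaves like \<open>D n 0 * b ^ n / n!\<close> near \<open>0\<close>, so
  \<open>D n 0 < 0\<close> would make \<open>D 0\<close> negative immediately to the right of \<open>0\<close>.\<close>

lemma leading_derivative_nonneg:
  fixes D :: "nat \<Rightarrow> real \<Rightarrow> real"
  assumes "0 < e" and D: "\<And>m b. m < n \<Longrightarrow> (D m has_real_derivative D (Suc m) b) (at b)"
    and cont: "continuous_on UNIV (D n)"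
    and vanish: "\<And>m. m < n \<Longrightarrow> D m 0 = 0"
    and pos: "\<And>b. 0 < b \<Longrightarrow> b < e \<Longrightarrow> 0 \<le> D 0 b"
  shows "0 \<le> D n 0"
proof (rule ccontr)
  assume "\<not> 0 \<le> D n 0"
  moreover have "isCont (D n) 0"
    using cont by (simp add: continuous_on_eq_continuous_at)
  ultimately have "\<forall>\<^sub>F b in at 0. D n b < 0"
    by (auto simp: isCont_def intro: order_tendstoD)
  then obtain d where d: "0 < d" "\<And>b. b \<noteq> 0 \<Longrightarrow> \<bar>b\<bar> < d \<Longrightarrow> D n b < 0"
    by (auto simp: eventually_at)
  define b where "b = min d e / 2"
  have b: "0 < b" "b < d" "b < e"
    using d(1) \<open>0 < e\<close> by (auto simp: b_def min_def)
  have "D 0 b < 0"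
  proof (cases "n = 0")
    case True
    then show ?thesis using d(2)[of b] b by simp
  next
    case False
    then obtain t where t: "0 < t" "t < b"
      "D 0 b = (\<Sum>m<n. D m 0 / fact m * b ^ m) + D n t / fact n * b ^ n"
      using Maclaurin[of b n D "D 0"] b D by auto
    have "D n t < 0"
      using d(2)[of t] t b by simp
    then have "D n t / fact n * b ^ n < 0"
      using b by (simp add: divide_neg_pos mult_neg_pos)
    then show ?thesis
      using t vanish by simp
  qed
  then show False
    using pos[of b] b by simp
qed

text \<open>This is the heart of the argument. For a smooth \<open>G\<close> the sum
  \<open>\<Sum>k. c k * G (x + b * u ^ k)\<close>, with \<open>c\<close> the coefficients of a polynomial \<open>p\<close>, has the Taylor
  expansion \<open>\<Sum>m. p (u ^ m) * G\<^sup>(\<^sup>m\<^sup>) x * b ^ m / m!\<close> in \<open>b\<close>. The square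
  \<open>p = (\<Prod>j<n. X - u ^ j)\<^sup>2\<close> kills the terms with \<open>m < n\<close> and is positive at \<open>u ^ n\<close>; nonnegativity
  of the sum for small \<open>b\<close> therefore says that the \<open>n\<close>-th derivative of \<open>G\<close> is nonnegative at \<open>x\<close>.

  A function \<open>f\<close> that is only continuous is handled by applying this to the \<open>n\<close>-th difference \<open>G\<close> of
  the \<open>n\<close>-th antiderivative of \<open>f\<close>. Up to a power of \<open>h\<close>, this \<open>G\<close> is an average of
  translates of \<open>f\<close> and so inherits the hypothesis, and its \<open>n\<close>-th derivative is exactly the \<open>n\<close>-th difference of \<open>f\<close>.\<close>

lemma fdiff_pow_nonneg:
  fixes f :: "real \<Rightarrow> real"
  assumes u: "0 < u" "u < 1" and cont: "continuous_on UNIV f"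
    and test: "\<And>p a b. (\<And>x. 0 \<le> poly p x) \<Longrightarrow> 0 \<le> a \<Longrightarrow> 0 < b \<Longrightarrow> a + b < c \<Longrightarrow>
        0 \<le> (\<Sum>k\<le>degree p. coeff p k * f (a + b * u ^ k))"
    and "0 \<le> h" "0 \<le> x" "x + real n * h < c"
  shows "0 \<le> (fdiff h ^^ n) f x"
proof -
  define p where "p = (\<Prod>j<n. [:- (u ^ j), 1:])\<^sup>2"
  have poly_p: "poly p y = (\<Prod>j<n. y - u ^ j)\<^sup>2" for y
    by (simp add: p_def poly_power poly_prod)
  have p_root: "poly p (u ^ m) = 0" if "m < n" for m
    using that by (auto simp: poly_p)
  have "u ^ n \<noteq> u ^ j" if "j < n" for j
    using power_strict_decreasing[OF that u] by simp
  then have p_lead: "0 < poly p (u ^ n)"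
    by (simp add: poly_p)
  obtain J where J: "J 0 = f" "\<And>m x. (J (Suc m) has_real_derivative J m x) (at x)"
    using antiderivative_sequence[OF cont] by blast
  \<comment> \<open>Combining the nodes \<open>b * u ^ k\<close> commutes with differences and with antiderivatives.\<close>
  define S where "S b m x = (\<Sum>k\<le>degree p. coeff p k * J m (x + b * u ^ k))" for b m x
  \<comment> \<open>For \<open>m \<le> n\<close>, \<open>G m\<close> is the \<open>m\<close>-th derivative of \<open>G 0\<close>, and \<open>D m\<close> that of the test sum as a function of \<open>b\<close>.\<close>
  define G where "G m = (fdiff h ^^ n) (J (n - m))" for m
  define D where "D m b = (\<Sum>k\<le>degree p. coeff p k * (u ^ m) ^ k * G m (x + b * u ^ k))" for m b
  have G: "(G m has_real_derivative G (Suc m) y) (at y)" if "m < n" for m y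
  proof -
    have "n - m = Suc (n - Suc m)" using that by simp
    then show ?thesis
      unfolding G_def by (metis DERIV_fdiff_pow J(2))
  qed
  have "0 \<le> D n 0"
  proof (rule leading_derivative_nonneg)
    show "0 < c - (x + real n * h)"
      using assms by simp
  next
    fix b assume b: "0 < b" "b < c - (x + real n * h)"
    have "0 \<le> (fdiff h ^^ n) (S b n) x"
    proof (rule fdiff_pow_antiderivative_nonneg[where d = "c - b" and J = "S b"])
      show "(S b (Suc m) has_real_derivative S b m y) (at y)" for m y
        unfolding S_def
        by (intro DERIV_sum DERIV_cmult) (rule iffD1[OF DERIV_shift], rule J)
      show "0 \<le> S b 0 y" if "0 \<le> y" "y < c - b" for y
        unfolding S_def J(1) using that b by (intro test) (auto simp: poly_p)
    qed (use assms b in auto)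
    also have "(fdiff h ^^ n) (S b n) x = D 0 b"
      by (simp add: S_def[abs_def] D_def G_def fdiff_pow_sum_shift[where c = "coeff p" and r = "\<lambda>k. b * u ^ k"])
    finally show "0 \<le> D 0 b" .
  next
    fix m b assume "m < n"
    have "((\<lambda>b. G m (x + b * u ^ k)) has_real_derivative G (Suc m) (x + b * u ^ k) * u ^ k) (at b)" for k
      by (rule DERIV_chain2[OF G[OF \<open>m < n\<close>]]) (auto intro!: derivative_eq_intros)
    then have "((\<lambda>b. \<Sum>k\<le>degree p. coeff p k * (u ^ m) ^ k * G m (x + b * u ^ k)) has_real_derivative
        (\<Sum>k\<le>degree p. coeff p k * (u ^ m) ^ k * (G (Suc m) (x + b * u ^ k) * u ^ k))) (at b)"
      by (intro DERIV_sum DERIV_cmult)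
    then show "(D m has_real_derivative D (Suc m) b) (at b)"
      by (simp add: D_def[abs_def] power_mult_distrib mult_ac)
  next
    have "continuous_on UNIV (G n)"
      by (simp add: G_def J(1) cont continuous_fdiff_pow)
    then have "continuous_on UNIV (\<lambda>b. G n (x + b * u ^ k))" for k
      by (rule continuous_on_compose2) (auto intro!: continuous_intros)
    then show "continuous_on UNIV (D n)"
      unfolding D_def by (intro continuous_on_sum continuous_on_mult continuous_on_const)
  next
    fix m assume "m < n"
    have "D m 0 = poly p (u ^ m) * G m x"
      by (simp add: D_def poly_altdef sum_distrib_right)
    with p_root \<open>m < n\<close> show "D m 0 = 0"
      by simp
  qed
  also have "D n 0 = poly p (u ^ n) * (fdiff h ^^ n) f x"
    by (simp add: D_def G_def J(1) poly_altdef sum_distrib_right)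
  finally show ?thesis
    using p_lead by (simp add: zero_le_mult_iff)
qed


section \<open>Bernstein polynomials have nonnegative coefficients\<close>

lemma binomial_sum_Suc:
  fixes y z :: real
  shows "(\<Sum>k\<le>Suc N. real (Suc N choose k) * y ^ k * z ^ (Suc N - k) * c k) =
    z * (\<Sum>k\<le>N. real (N choose k) * y ^ k * z ^ (N - k) * c k) +
    y * (\<Sum>k\<le>N. real (N choose k) * y ^ k * z ^ (N - k) * c (Suc k))"
proof -
  have "z * (\<Sum>k\<le>N. real (N choose k) * y ^ k * z ^ (N - k) * c k) =
      (\<Sum>k\<le>N. real (N choose k) * y ^ k * z ^ (Suc N - k) * c k)"
    by (auto simp: sum_distrib_left Suc_diff_le intro!: sum.cong)
  also have "\<dots> = (\<Sum>k\<le>Suc N. real (N choose k) * y ^ k * z ^ (Suc N - k) * c k)"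
    by simp
  also have "\<dots> = z ^ Suc N * c 0 +
      (\<Sum>k\<le>N. real (N choose Suc k) * y ^ Suc k * z ^ (N - k) * c (Suc k))"
    by (subst sum.atMost_Suc_shift) simp
  finally show ?thesis
    by (subst sum.atMost_Suc_shift)
       (simp add: sum_distrib_left sum.distrib algebra_simps)
qed

text \<open>With \<open>E\<close> the shift by \<open>h\<close>, this is the operator identity
  \<open>((1 - y) I + y E) ^ N = (I + y (E - I)) ^ N\<close>: it turns Bernstein polynomials into polynomials
  whose monomial coefficients are forward differences.\<close>

lemma Bernstein_Newton_form:
  "(\<Sum>k\<le>N. f (x + real k * h) * Bernstein N k y) =
    (\<Sum>k\<le>N. real (N choose k) * y ^ k * (fdiff h ^^ k) f x)"
proof -
  define B where
    "B N f x = (\<Sum>k\<le>N. real (N choose k) * y ^ k * (1 - y) ^ (N - k) * f (x + real k * h))"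
    for N f x
  have B_Suc: "B (Suc N) f x = (1 - y) * B N f x + y * B N f (x + h)" for N f x
    unfolding B_def by (subst binomial_sum_Suc) (simp add: algebra_simps)
  have B_fdiff: "B N (fdiff h f) x = B N f (x + h) - B N f x" for N f x
    by (simp add: B_def fdiff_def right_diff_distrib sum_subtractf add_ac)
  have "B N f x = (\<Sum>k\<le>N. real (N choose k) * y ^ k * (fdiff h ^^ k) f x)"
  proof (induction N arbitrary: f)
    case 0
    show ?case by (simp add: B_def)
  next
    case (Suc N)
    have "(\<Sum>k\<le>Suc N. real (Suc N choose k) * y ^ k * (fdiff h ^^ k) f x) =
        (\<Sum>k\<le>N. real (N choose k) * y ^ k * (fdiff h ^^ k) f x) +
        y * (\<Sum>k\<le>N. real (N choose k) * y ^ k * (fdiff h ^^ k) (fdiff h f) x)"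
      using binomial_sum_Suc[of N y 1 "\<lambda>k. (fdiff h ^^ k) f x"]
      by (simp add: funpow_swap1 del: sum.atMost_Suc)
    also have "\<dots> = B N f x + y * B N (fdiff h f) x"
      by (simp only: Suc.IH)
    also have "\<dots> = B (Suc N) f x"
      by (simp add: B_Suc B_fdiff algebra_simps)
    finally show ?case ..
  qed
  then show ?thesis
    by (simp add: B_def Bernstein_def mult_ac)
qed

text \<open>The approximants are the Bernstein polynomials of \<open>f\<close> rescaled to \<open>[0,d]\<close>.\<close>

lemma nonneg_polynomial_approximation:
  assumes cont: "continuous_on UNIV f" and "0 < d" "0 < e"
    and diff: "\<And>h k. 0 \<le> h \<Longrightarrow> real k * h \<le> d \<Longrightarrow> 0 \<le> (fdiff h ^^ k) f 0"
  obtains p where "\<And>k. 0 \<le> coeff p k" "\<And>x. 0 \<le> x \<Longrightarrow> x \<le> d \<Longrightarrow> \<bar>f x - poly p x\<bar> < e"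
proof -
  have "continuous_on {0..1} (\<lambda>y. f (d * y))"
    by (intro continuous_on_compose2[OF cont] continuous_intros) auto
  from Bernstein_Weierstrass[OF this \<open>0 < e\<close>] obtain N0 where
    N0: "\<And>n y. N0 \<le> n \<Longrightarrow> y \<in> {0..1} \<Longrightarrow>
      \<bar>f (d * y) - (\<Sum>k\<le>n. f (d * (real k / real n)) * Bernstein n k y)\<bar> < e"
    by blast
  \<comment> \<open>The step \<open>h = d / N\<close> requires \<open>N > 0\<close>.\<close>
  define N where "N = Suc N0"
  define h where "h = d / real N"
  define p where "p = (\<Sum>k\<le>N. monom (real (N choose k) * (fdiff h ^^ k) f 0 / d ^ k) k)"
  have h: "0 \<le> h" "real k * h \<le> d" if "k \<le> N" for k
  proof -
    have "d * (real k / real N) \<le> d * 1"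
      using that \<open>0 < d\<close> by (intro mult_left_mono) (auto simp: N_def field_simps)
    then show "0 \<le> h" "real k * h \<le> d"
      using \<open>0 < d\<close> by (auto simp: h_def mult_ac)
  qed
  show ?thesis
  proof (rule that)
    fix k
    show "0 \<le> coeff p k"
      using h diff \<open>0 < d\<close> by (auto simp: p_def coeff_sum intro!: sum_nonneg)
  next
    fix x assume x: "0 \<le> x" "x \<le> d"
    have "poly p x = (\<Sum>k\<le>N. real (N choose k) * (x / d) ^ k * (fdiff h ^^ k) f 0)"
      by (simp add: p_def poly_sum poly_monom power_divide mult_ac)
    also have "\<dots> = (\<Sum>k\<le>N. f (0 + real k * h) * Bernstein N k (x / d))"
      by (rule Bernstein_Newton_form[symmetric])
    also have "\<dots> = (\<Sum>k\<le>N. f (d * (real k / real N)) * Bernstein N k (x / d))"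
      by (simp add: h_def mult_ac)
    finally show "\<bar>f x - poly p x\<bar> < e"
      using N0[of N "x / d"] x \<open>0 < d\<close> by (simp add: N_def)
  qed
qed

section \<open>Limits of polynomials with nonnegative coefficients\<close>

lemma poly_nonneg_coeffs_mono:
  fixes p :: "real poly"
  assumes "\<And>k. 0 \<le> coeff p k" "0 \<le> x" "x \<le> y"
  shows "poly p x \<le> poly p y"
  unfolding poly_altdef using assms by (intro sum_mono mult_left_mono power_mono) auto

lemma norm_poly_le_poly_norm:
  assumes "\<And>k. 0 \<le> coeff p k"
  shows "norm (poly (map_poly complex_of_real p) z) \<le> poly p (norm z)"
proof -
  have "norm (poly (map_poly complex_of_real p) z) \<le>
      (\<Sum>k\<le>degree p. norm (complex_of_real (coeff p k) * z ^ k))"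
    by (simp add: poly_altdef degree_map_poly coeff_map_poly) (rule norm_sum)
  also have "\<dots> = poly p (norm z)"
    using assms by (simp add: poly_altdef norm_mult norm_power)
  finally show ?thesis .
qed

lemma higher_deriv_nonneg_coeffs:
  assumes "\<And>k. 0 \<le> coeff p k" "0 \<le> x"
  shows "(deriv ^^ n) (poly (map_poly complex_of_real p)) (complex_of_real x) \<in> \<real>\<^sub>\<ge>\<^sub>0"
proof -
  have nonneg: "0 \<le> coeff ((pderiv ^^ n) p) k" for n k
    by (induction n arbitrary: k) (simp_all add: assms coeff_pderiv)
  have pderiv_map: "pderiv (map_poly complex_of_real q) = map_poly complex_of_real (pderiv q)" for q
    by (simp add: poly_eq_iff coeff_pderiv coeff_map_poly)
  have deriv_poly: "deriv (poly q) = poly (pderiv q)" for q :: "complex poly"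
    by (simp add: fun_eq_iff DERIV_imp_deriv[OF poly_DERIV])
  have "(deriv ^^ n) (poly (map_poly complex_of_real p)) =
      poly (map_poly complex_of_real ((pderiv ^^ n) p))" for n
    by (induction n) (simp_all add: deriv_poly pderiv_map)
  moreover have "poly (map_poly complex_of_real q) (complex_of_real x) = complex_of_real (poly q x)" for q
    by (simp add: poly_altdef degree_map_poly coeff_map_poly)
  moreover have "0 \<le> poly ((pderiv ^^ n) p) x"
    unfolding poly_altdef using nonneg assms by (intro sum_nonneg) auto
  ultimately show ?thesis
    by simp
qed

lemma open_ereal_disc: "open {z::complex. ereal (norm z) < \<rho>}"
  by (intro open_Collect_less continuous_intros continuous_on_ereal)

text \<open>A polynomial with nonnegative coefficients is bounded on the disc of radius \<open>r\<close> by its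
  value at \<open>r\<close>. Pointwise convergence on \<open>(0,\<rho>)\<close> thus makes the sequence locally bounded on the
  complex disc, and Montel's theorem yields a subsequence that converges to a holomorphic function,
  together with all derivatives; their signs survive in the limit.\<close>

lemma abs_monotonic_entire_limit:
  assumes coeff: "\<And>N k. 0 \<le> coeff (p N) k"
    and lim: "\<And>x. 0 < x \<Longrightarrow> ereal x < \<rho> \<Longrightarrow> (\<lambda>N. poly (p N) x) \<longlonglongrightarrow> F x"
    and "0 < \<rho>"
  obtains g where "abs_monotonic_entire \<rho> g"
    "\<And>x. 0 < x \<Longrightarrow> ereal x < \<rho> \<Longrightarrow> complex_of_real (F x) = g (complex_of_real x)"
proof -
  define S where "S = {z::complex. ereal (norm z) < \<rho>}"
  define P where "P N = poly (map_poly complex_of_real (p N))" for N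
  have opS: "open S"
    unfolding S_def by (rule open_ereal_disc)
  have P_of_real: "P N (complex_of_real x) = complex_of_real (poly (p N) x)" for N x
    by (simp add: P_def poly_altdef degree_map_poly coeff_map_poly)
  have P_holo: "P N holomorphic_on A" for N A
    unfolding P_def by (intro holomorphic_intros)
  have bounded: "\<exists>B. \<forall>h\<in>range P. \<forall>z\<in>K. norm (h z) \<le> B" if K: "compact K" "K \<subseteq> S" for K
  proof (cases "K = {}")
    case False
    then obtain z0 where z0: "z0 \<in> K" "\<And>z. z \<in> K \<Longrightarrow> norm z \<le> norm z0"
      using continuous_attains_sup[OF K(1) False continuous_on_norm_id] by blast
    then have "ereal (norm z0) < \<rho>"
      using K by (auto simp: S_def)
    then obtain r where r: "ereal (norm z0) < ereal r" "ereal r < \<rho>"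
      using ereal_dense2 by blast
    then have "0 < r"
      using norm_ge_zero[of z0] by (simp del: norm_ge_zero)
    then have "Bseq (\<lambda>N. poly (p N) r)"
      using lim[of r] r by (intro convergent_imp_Bseq convergentI) auto
    then obtain B where B: "\<And>N. norm (poly (p N) r) \<le> B"
      unfolding Bseq_def by blast
    have "norm (P N z) \<le> B" if "z \<in> K" for N z
    proof -
      have "norm (P N z) \<le> poly (p N) (norm z)"
        unfolding P_def by (rule norm_poly_le_poly_norm[OF coeff])
      also have "\<dots> \<le> poly (p N) r"
        using z0(2)[OF that] r by (intro poly_nonneg_coeffs_mono coeff) auto
      also have "\<dots> \<le> B"
        using B[of N] by simp
      finally show ?thesis .
    qed
    then show ?thesis by blast
  qed simp
  obtain g r where g: "g holomorphic_on S" and r: "strict_mono r"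
    and ptw: "\<And>z. z \<in> S \<Longrightarrow> (\<lambda>n. P (r n) z) \<longlonglongrightarrow> g z"
    and unif: "\<And>K. compact K \<Longrightarrow> K \<subseteq> S \<Longrightarrow> uniform_limit K (P \<circ> r) g sequentially"
    using Montel[OF opS, of "range P" P] P_holo bounded by blast
  have "abs_monotonic_entire \<rho> g"
    unfolding abs_monotonic_entire_def
  proof (intro conjI allI impI)
    show "g holomorphic_on {z. ereal (norm z) < \<rho>}"
      using g by (simp add: S_def)
    fix x n assume x: "0 < x \<and> ereal x < \<rho>"
    then have "complex_of_real x \<in> S"
      by (simp add: S_def)
    then obtain e where e: "0 < e" "cball (complex_of_real x) e \<subseteq> S"
      using opS open_contains_cball by blast
    have "uniform_limit (ball (complex_of_real x) e) (P \<circ> r) g sequentially"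
      by (rule uniform_limit_on_subset[OF unif[OF compact_cball e(2)] ball_subset_cball])
    then have lim_deriv: "(\<lambda>m. (deriv ^^ n) ((P \<circ> r) m) (complex_of_real x)) \<longlonglongrightarrow> (deriv ^^ n) g (complex_of_real x)"
      by (rule higher_deriv_complex_uniform_limit) (use e P_holo in auto)
    have "(deriv ^^ n) ((P \<circ> r) m) (complex_of_real x) \<in> \<real>\<^sub>\<ge>\<^sub>0" for m
      unfolding P_def o_def by (rule higher_deriv_nonneg_coeffs) (use coeff x in auto)
    from closed_sequentially[OF closed_nonneg_Reals_complex this lim_deriv]
    have "(deriv ^^ n) g (complex_of_real x) \<in> \<real>\<^sub>\<ge>\<^sub>0" .
    then show "(deriv ^^ n) g (complex_of_real x) / fact n \<in> \<real>\<^sub>\<ge>\<^sub>0"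
      by (intro nonneg_Reals_divide_I) (auto simp: complex_nonneg_Reals_iff)
  qed
  moreover have "complex_of_real (F x) = g (complex_of_real x)" if "0 < x" "ereal x < \<rho>" for x
  proof (rule LIMSEQ_unique)
    show "(\<lambda>n. P (r n) (complex_of_real x)) \<longlonglongrightarrow> g (complex_of_real x)"
      using that by (intro ptw) (simp add: S_def)
    show "(\<lambda>n. P (r n) (complex_of_real x)) \<longlonglongrightarrow> complex_of_real (F x)"
      using LIMSEQ_subseq_LIMSEQ[OF lim[OF that] r] unfolding P_of_real o_def
      by (rule tendsto_of_real)
  qed
  ultimately show ?thesis
    using that by blast
qed

section \<open>Regularity of transforms of two-atom measures\<close>

lemma transform_test_polynomial:
  assumes "entrywise_sends F (moment_seqs_lt \<rho> {x, y}) (moment_seqs UNIV)"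
    and "0 < \<rho>" "x \<noteq> y" "x \<in> {0..1}" "y \<in> {0..1}" "0 \<le> a" "0 \<le> b" "ereal (a + b) < \<rho>"
    and "\<And>x. 0 \<le> poly p x"
  shows "0 \<le> (\<Sum>k\<le>degree p. coeff p k * F (a * x ^ k + b * y ^ k))"
proof (rule moment_seqs_poly_nonneg)
  show "(\<lambda>k. F (a * x ^ k + b * y ^ k)) \<in> moment_seqs UNIV"
    using bspec[OF assms(1)[unfolded entrywise_sends_def] two_atom_moment_seq_lt[OF assms(2-8)]] .
qed (rule assms(9))

text \<open>A measure with masses \<open>b - a\<close> at \<open>0\<close> and \<open>a\<close> at \<open>1\<close> has the moments \<open>b, a, a, \<dots>\<close>. The
  transformed sequence \<open>F b, F a, F a, \<dots>\<close> is tested against \<open>(x - 1)\<^sup>2\<close>.\<close>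

lemma transform_nonneg_mono:
  assumes "entrywise_sends F (moment_seqs_lt \<rho> {0, 1}) (moment_seqs UNIV)" "0 < \<rho>"
    and ab: "0 \<le> a" "a \<le> b" "ereal b < \<rho>"
  shows "0 \<le> F a" "F a \<le> F b"
proof -
  have "ereal a < \<rho>"
    using ab by (meson ereal_less_eq(3) le_less_trans)
  with transform_test_polynomial[OF assms(1,2), of a 0 "[:1:]"] ab
  show "0 \<le> F a"
    by (simp add: insert_commute)
  let ?p = "[:-1, 1:]\<^sup>2 :: real poly"
  have "0 \<le> (\<Sum>k\<le>degree ?p. coeff ?p k * F ((b - a) * 0 ^ k + a * 1 ^ k))"
    using ab by (intro transform_test_polynomial[OF assms(1,2)]) auto
  then show "F a \<le> F b"
    by (simp add: power2_eq_square)
qed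

text \<open>At a jump, let \<open>l\<close> and \<open>r\<close> be the left and right limits. Choosing \<open>a < x < b\<close> close to \<open>x\<close> with
  geometric mean above \<open>x\<close>, the inequality gives \<open>r\<^sup>2 \<le> l * r\<close> in the limit, so there is no jump.\<close>

lemma mono_log_convex_continuous:
  fixes F :: "real \<Rightarrow> real"
  assumes nonneg: "\<And>x. 0 < x \<Longrightarrow> ereal x < \<rho> \<Longrightarrow> 0 \<le> F x"
    and mono: "\<And>x y. 0 < x \<Longrightarrow> x \<le> y \<Longrightarrow> ereal y < \<rho> \<Longrightarrow> F x \<le> F y"
    and conv: "\<And>a b. 0 < a \<Longrightarrow> ereal a < \<rho> \<Longrightarrow> 0 < b \<Longrightarrow> ereal b < \<rho> \<Longrightarrow> (F (sqrt (a * b)))\<^sup>2 \<le> F a * F b"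
  shows "continuous_on {x. 0 < x \<and> ereal x < \<rho>} F"
proof (rule continuous_at_imp_continuous_on, rule ballI)
  fix x assume "x \<in> {x. 0 < x \<and> ereal x < \<rho>}"
  then have x: "0 < x" "ereal x < \<rho>" by auto
  define l where "l = Sup (F ` {0<..<x})"
  define r where "r = Inf (F ` {y. x < y \<and> ereal y < \<rho>})"
  obtain y0 where y0: "x < y0" "ereal y0 < \<rho>"
    using ereal_dense2[OF x(2)] by auto
  have ne: "{0<..<x} \<noteq> {}" "{y. x < y \<and> ereal y < \<rho>} \<noteq> {}"
    using x(1) y0 by (auto intro: dense)
  have less: "ereal a < \<rho>" if "a < b" "ereal b < \<rho>" for a b
    using that by (meson ereal_less_eq(3) le_less_trans less_imp_le)
  have bdd: "bdd_above (F ` {0<..<x})" "bdd_below (F ` {y. x < y \<and> ereal y < \<rho>})"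
    using x mono by (auto intro!: bdd_aboveI[of _ "F x"] bdd_belowI[of _ "F x"])
  have l_le: "l \<le> F x" and le_r: "F x \<le> r"
    unfolding l_def r_def using x mono ne
    by (auto intro!: cSUP_least cINF_greatest)
  have F_le_l: "F a \<le> l" if "0 < a" "a < x" for a
    unfolding l_def using that by (intro cSUP_upper bdd) auto
  have r_le_F: "r \<le> F b" if "x < b" "ereal b < \<rho>" for b
    unfolding r_def using that by (intro cINF_lower bdd) auto
  have r0: "0 \<le> r"
    using nonneg[OF x] le_r by simp
  have l0: "0 \<le> l"
    using F_le_l[of "x / 2"] nonneg[of "x / 2"] less[of "x/2" x] x by auto
  have r_sq: "r\<^sup>2 \<le> l * F b" if b: "x < b" "ereal b < \<rho>" for b
  proof -
    obtain a where a: "x\<^sup>2 / b < a" "a < x"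
      using dense[of "x\<^sup>2 / b" x] b x by (auto simp: field_simps power2_eq_square)
    have "0 < x\<^sup>2 / b"
      using x b by simp
    with a have a0: "0 < a" by linarith
    have "x\<^sup>2 < a * b"
      using a b x by (simp add: field_simps)
    then have "x < sqrt (a * b)"
      using x by (simp add: real_less_rsqrt)
    moreover have "sqrt (a * b) < b"
    proof (rule real_less_lsqrt)
      show "a * b < b\<^sup>2"
        using a b x by (simp add: power2_eq_square)
    qed (use b x in auto)
    ultimately have "r \<le> F (sqrt (a * b))"
      using less b by (intro r_le_F) auto
    then have "r\<^sup>2 \<le> (F (sqrt (a * b)))\<^sup>2"
      using r0 by (rule power_mono)
    also have "\<dots> \<le> F a * F b"
      using less[of a x] a a0 b x by (intro conv) auto
    also have "\<dots> \<le> l * F b"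
      using F_le_l[OF a0 a(2)] nonneg[of b] b x by (intro mult_right_mono) auto
    finally show ?thesis .
  qed
  have "r \<le> l"
  proof (cases "l = 0")
    case True
    then show ?thesis
      using r_sq[OF y0] by simp
  next
    case False
    with l0 have l: "0 < l" by simp
    have "r\<^sup>2 / l \<le> r"
      unfolding r_def using r_sq ne l
      by (intro cINF_greatest) (auto simp: r_def[symmetric] field_simps)
    then have "r * r \<le> l * r"
      using l by (simp add: field_simps power2_eq_square)
    then show ?thesis
      using l r0 by (cases "r = 0") auto
  qed
  then have eq: "l = F x" "r = F x"
    using l_le le_r by auto
  show "isCont F x"
    unfolding isCont_def
  proof (rule order_tendstoI)
    fix c assume "c < F x"
    then obtain a where a: "0 < a" "a < x" "c < F a"
      using less_cSUP_iff[OF ne(1) bdd(1), of c] unfolding eq(1)[symmetric] l_def by auto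
    have "\<forall>\<^sub>F y in at x. a < y \<and> y < y0"
      using a y0 by (intro eventually_conj order_tendstoD[OF tendsto_ident_at]) auto
    then show "\<forall>\<^sub>F y in at x. c < F y"
    proof eventually_elim
      case (elim y)
      then have "F a \<le> F y"
        using a less[OF _ y0(2)] by (intro mono) auto
      with a show ?case by simp
    qed
  next
    fix c assume "F x < c"
    then obtain b where b: "x < b" "ereal b < \<rho>" "F b < c"
      using cINF_less_iff[OF ne(2) bdd(2), of c] unfolding eq(2)[symmetric] r_def by auto
    have "\<forall>\<^sub>F y in at x. 0 < y \<and> y < b"
      using b x by (intro eventually_conj order_tendstoD[OF tendsto_ident_at]) auto
    then show "\<forall>\<^sub>F y in at x. F y < c"
    proof eventually_elim
      case (elim y)
      then have "F y \<le> F b"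
        using b by (intro mono) auto
      with b show ?case by simp
    qed
  qed
qed

lemma mono_right_limit:
  fixes F :: "real \<Rightarrow> real"
  assumes "0 < d" and lower: "\<And>x. 0 < x \<Longrightarrow> x \<le> d \<Longrightarrow> m \<le> F x"
    and mono: "\<And>x y. 0 < x \<Longrightarrow> x \<le> y \<Longrightarrow> y \<le> d \<Longrightarrow> F x \<le> F y"
  obtains L where "(F \<longlongrightarrow> L) (at_right 0)" "m \<le> L"
proof -
  define L where "L = Inf (F ` {0<..d})"
  have ne: "{0<..d} \<noteq> {}"
    using \<open>0 < d\<close> by auto
  have bdd: "bdd_below (F ` {0<..d})"
    using lower by (auto intro!: bdd_belowI[of _ m])
  have "(F \<longlongrightarrow> L) (at_right 0)"
  proof (rule order_tendstoI)
    fix c assume c: "c < L"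
    have "\<forall>\<^sub>F x in at_right 0. 0 < x \<and> x < d"
      using \<open>0 < d\<close> by (intro eventually_conj eventually_at_right_less order_tendstoD[OF tendsto_ident_at]) auto
    then show "\<forall>\<^sub>F x in at_right 0. c < F x"
    proof eventually_elim
      case (elim x)
      then have "L \<le> F x"
        unfolding L_def by (intro cINF_lower bdd) auto
      with c show ?case by simp
    qed
  next
    fix c assume "L < c"
    then obtain b where b: "0 < b" "b \<le> d" "F b < c"
      using cINF_less_iff[OF ne bdd, of c] unfolding L_def by auto
    have "\<forall>\<^sub>F x in at_right 0. 0 < x \<and> x < b"
      using b by (intro eventually_conj eventually_at_right_less order_tendstoD[OF tendsto_ident_at]) auto
    then show "\<forall>\<^sub>F x in at_right 0. F x < c"
    proof eventually_elim
      case (elim y)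
      then have "F y \<le> F b"
        using b by (intro mono) auto
      with b show ?case by simp
    qed
  qed
  moreover have "m \<le> L"
    unfolding L_def using ne lower by (intro cINF_greatest) auto
  ultimately show ?thesis
    using that by blast
qed

lemma continuous_extension_clamped:
  fixes F :: "real \<Rightarrow> real"
  assumes "0 < c" and L: "(F \<longlongrightarrow> L) (at_right 0)"
    and cont: "\<And>x. 0 < x \<Longrightarrow> x \<le> c \<Longrightarrow> isCont F x"
  shows "continuous_on UNIV (\<lambda>x. if x \<le> 0 then L else F (min x c))"
proof -
  define H where "H x = (if x \<le> 0 then L else F x)" for x
  have H_eq: "\<forall>\<^sub>F y in at x within A. F y = H y" if "0 < x" for x A
  proof -
    have "\<forall>\<^sub>F y in at x within A. 0 < y"
      using that by (intro order_tendstoD[OF tendsto_ident_at])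
    then show ?thesis
      by eventually_elim (simp add: H_def)
  qed
  have H_lim: "(H \<longlongrightarrow> H x) (at x within A)" if "0 < x" "x \<le> c" for x A
  proof (rule Lim_transform_eventually[OF _ H_eq])
    have "(F \<longlongrightarrow> F x) (at x within A)"
      using cont[OF that] unfolding isCont_def by (rule tendsto_within_subset) simp
    then show "(F \<longlongrightarrow> H x) (at x within A)"
      using that by (simp add: H_def)
  qed (use that in simp)
  have "continuous_on {0..c} H"
  proof (rule continuous_on_IccI)
    have "\<forall>\<^sub>F x in at_right 0. F x = H x"
      using eventually_at_right_less[of "0::real"] by eventually_elim (simp add: H_def)
    from Lim_transform_eventually[OF L this] show "(H \<longlongrightarrow> H 0) (at_right 0)"
      by (simp add: H_def[of 0])
  qed (use H_lim \<open>0 < c\<close> in auto)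
  then have "continuous_on UNIV (\<lambda>x. H (max 0 (min x c)))"
    by (rule continuous_on_compose2) (use \<open>0 < c\<close> in \<open>auto intro!: continuous_intros\<close>)
  moreover have "H (max 0 (min x c)) = (if x \<le> 0 then L else F (min x c))" for x
    using \<open>0 < c\<close> by (auto simp: H_def max_def min_def)
  ultimately show ?thesis
    by simp
qed

section \<open>From test inequalities to absolute monotonicity\<close>

text \<open>A variant of Bernstein's theorem on absolutely monotonic functions. On each \<open>[0,d]\<close> with
  \<open>d < \<rho>\<close> the differences of \<open>F\<close>, with the value at \<open>0\<close> replaced by the right limit \<open>L\<close>, are
  nonnegative, so \<open>F\<close> is close there to a polynomial with nonnegative coefficients. Letting \<open>d\<close>
  increase to \<open>\<rho>\<close> produces polynomials converging to \<open>F\<close> on all of \<open>(0,\<rho>)\<close>.\<close>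

lemma absolutely_monotonic_of_test_inequalities:
  fixes F :: "real \<Rightarrow> real"
  assumes "0 < \<rho>" and u: "0 < u" "u < 1"
    and cont: "continuous_on {x. 0 < x \<and> ereal x < \<rho>} F" and L: "(F \<longlongrightarrow> L) (at_right 0)"
    and test: "\<And>p a b. (\<And>x. 0 \<le> poly p x) \<Longrightarrow> 0 \<le> a \<Longrightarrow> 0 < b \<Longrightarrow> ereal (a + b) < \<rho> \<Longrightarrow>
        0 \<le> (\<Sum>k\<le>degree p. coeff p k * F (a + b * u ^ k))"
  obtains g where "abs_monotonic_entire \<rho> g"
    "\<And>x. 0 < x \<Longrightarrow> ereal x < \<rho> \<Longrightarrow> complex_of_real (F x) = g (complex_of_real x)"
proof -
  have approx: "\<exists>p. (\<forall>k. 0 \<le> coeff p k) \<and> (\<forall>x. 0 < x \<longrightarrow> x \<le> d \<longrightarrow> \<bar>F x - poly p x\<bar> < e)"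
    if "0 < d" "ereal d < \<rho>" "0 < e" for d e
  proof -
    \<comment> \<open>Differences are controlled for \<open>x + k * h < c\<close>, but are needed up to \<open>k * h = d\<close>; hence \<open>d < c\<close>.\<close>
    obtain c where c: "d < c" "ereal c < \<rho>"
      using ereal_dense2[OF \<open>ereal d < \<rho>\<close>] by auto
    define f where "f = (\<lambda>x. if x \<le> 0 then L else F (min x c))"
    have f_eq: "f x = F x" if "0 < x" "x \<le> c" for x
      using that by (simp add: f_def)
    have below: "ereal x < \<rho>" if "x \<le> c" for x
      using that c by (meson ereal_less_eq(3) le_less_trans)
    have "open {x. 0 < x \<and> ereal x < \<rho>}"
      by (intro open_Collect_conj open_Collect_less continuous_intros continuous_on_ereal)
    then have "isCont F x" if "0 < x" "x \<le> c" for x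
      using cont below that by (auto simp: continuous_on_eq_continuous_at)
    then have cont_f: "continuous_on UNIV f"
      unfolding f_def using c \<open>0 < d\<close> L by (intro continuous_extension_clamped) auto
    have test_f: "0 \<le> (\<Sum>k\<le>degree p. coeff p k * f (a + b * u ^ k))"
      if "\<And>x. 0 \<le> poly p x" "0 \<le> a" "0 < b" "a + b < c" for p a b
    proof -
      have "f (a + b * u ^ k) = F (a + b * u ^ k)" for k
      proof (rule f_eq)
        show "0 < a + b * u ^ k"
          using that u by (intro add_nonneg_pos) auto
        have "b * u ^ k \<le> b"
          using that u by (intro mult_left_le power_le_one) auto
        then show "a + b * u ^ k \<le> c"
          using that by linarith
      qed
      then show ?thesis
        using test[OF that(1-3)] below that by simp
    qed
    have "0 \<le> (fdiff h ^^ k) f 0" if "0 \<le> h" "real k * h \<le> d" for h k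
      using that c by (intro fdiff_pow_nonneg[OF u cont_f test_f]) auto
    from nonneg_polynomial_approximation[OF cont_f \<open>0 < d\<close> \<open>0 < e\<close> this]
    obtain p where "\<And>k. 0 \<le> coeff p k" "\<And>x. 0 \<le> x \<Longrightarrow> x \<le> d \<Longrightarrow> \<bar>f x - poly p x\<bar> < e"
      by blast
    then show ?thesis
      using f_eq c by (intro exI[of _ p]) (metis less_imp_le order_trans)
  qed
  obtain X :: "nat \<Rightarrow> real" where X: "\<And>i. 0 < X i" "\<And>i. ereal (X i) < \<rho>" "X \<longlonglongrightarrow> \<rho>"
    using ereal_incseq_approx[OF \<open>0 < \<rho>\<close>] by (metis ereal_less(2) zero_ereal_def)
  have "\<exists>p. (\<forall>k. 0 \<le> coeff p k) \<and>
      (\<forall>x. 0 < x \<longrightarrow> x \<le> X i \<longrightarrow> \<bar>F x - poly p x\<bar> < 1 / real (Suc i))" for i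
    using approx[OF X(1,2)] by simp
  then obtain p where p: "\<And>i k. 0 \<le> coeff (p i) k"
    "\<And>i x. 0 < x \<Longrightarrow> x \<le> X i \<Longrightarrow> \<bar>F x - poly (p i) x\<bar> < 1 / real (Suc i)"
    by metis
  have "(\<lambda>i. poly (p i) x) \<longlonglongrightarrow> F x" if x: "0 < x" "ereal x < \<rho>" for x
  proof -
    have "\<forall>\<^sub>F i in sequentially. ereal x < ereal (X i)"
      using order_tendstoD(1)[OF X(3) x(2)] .
    then have "\<forall>\<^sub>F i in sequentially. norm (poly (p i) x - F x) \<le> 1 / real (Suc i)"
    proof eventually_elim
      case (elim i)
      with p(2)[OF x(1), of i] show ?case
        by (simp add: abs_minus_commute)
    qed
    then have "(\<lambda>i. poly (p i) x - F x) \<longlonglongrightarrow> 0"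
      by (rule Lim_null_comparison) (rule LIMSEQ_Suc[OF lim_1_over_n])
    then show ?thesis
      by (rule LIM_zero_cancel)
  qed
  from abs_monotonic_entire_limit[OF p(1) this \<open>0 < \<rho>\<close>] that show ?thesis
    by blast
qed

section \<open>Absolutely monotonic functions preserve moment sequences\<close>

text \<open>The derivatives are nonnegative on \<open>(0,\<rho>)\<close>, hence by continuity also at \<open>0\<close>; the series is the
  Taylor expansion at \<open>0\<close>.\<close>

lemma abs_monotonic_entire_power_series:
  assumes g: "abs_monotonic_entire \<rho> g" and "0 < \<rho>"
    and F: "\<And>x. 0 < x \<Longrightarrow> ereal x < \<rho> \<Longrightarrow> complex_of_real (F x) = g (complex_of_real x)"
  obtains a where "\<And>j. 0 \<le> a j" "\<And>x. 0 < x \<Longrightarrow> ereal x < \<rho> \<Longrightarrow> (\<lambda>j. a j * x ^ j) sums F x"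
proof -
  define S where "S = {z::complex. ereal (norm z) < \<rho>}"
  have holo: "g holomorphic_on S"
    using g by (simp add: abs_monotonic_entire_def S_def)
  have opS: "open S"
    unfolding S_def by (rule open_ereal_disc)
  define a where "a j = Re ((deriv ^^ j) g 0 / fact j)" for j
  have "(deriv ^^ j) g 0 / fact j \<in> \<real>\<^sub>\<ge>\<^sub>0" for j
  proof -
    obtain r where r: "0 < r" "ereal r < \<rho>"
      using ereal_dense2[OF \<open>0 < \<rho>\<close>] by auto
    define x where "x n = r / real (Suc n)" for n
    have x_less: "0 < x n" "ereal (x n) < \<rho>" for n
    proof -
      show "0 < x n"
        using r by (simp add: x_def)
      have "x n \<le> r"
        using r by (simp add: x_def field_simps)
      then show "ereal (x n) < \<rho>"
        using r by (meson ereal_less_eq(3) le_less_trans)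
    qed
    have "isCont ((deriv ^^ j) g) 0"
      using holomorphic_on_imp_continuous_on[OF holomorphic_higher_deriv[OF holo opS]] opS \<open>0 < \<rho>\<close>
      by (auto simp: continuous_on_eq_continuous_at S_def zero_ereal_def)
    moreover have "(\<lambda>n. complex_of_real (x n)) \<longlonglongrightarrow> of_real 0"
      unfolding x_def by (intro tendsto_of_real LIMSEQ_Suc[OF lim_const_over_n])
    ultimately have "(\<lambda>n. (deriv ^^ j) g (complex_of_real (x n)) / fact j) \<longlonglongrightarrow> (deriv ^^ j) g 0 / fact j"
      using isCont_tendsto_compose by (intro tendsto_divide) fastforce+
    moreover have "(deriv ^^ j) g (complex_of_real (x n)) / fact j \<in> \<real>\<^sub>\<ge>\<^sub>0" for n
      using g x_less by (auto simp: abs_monotonic_entire_def)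
    ultimately show ?thesis
      by (rule closed_sequentially[OF closed_nonneg_Reals_complex, rotated])
  qed
  then have "0 \<le> a j" for j
    by (simp add: a_def complex_nonneg_Reals_iff)
  moreover have "(\<lambda>j. a j * x ^ j) sums F x" if x: "0 < x" "ereal x < \<rho>" for x
  proof -
    obtain r where r: "x < r" "ereal r < \<rho>"
      using ereal_dense2[OF x(2)] by auto
    have "ball 0 r \<subseteq> S"
    proof
      fix z :: complex assume "z \<in> ball 0 r"
      then have "ereal (norm z) \<le> ereal r" by simp
      then show "z \<in> S"
        using r(2) unfolding S_def by (simp del: ereal_less_eq)
    qed
    then have "(\<lambda>n. (deriv ^^ n) g 0 / fact n * (complex_of_real x - 0) ^ n) sums g (complex_of_real x)"
      using r x by (intro holomorphic_power_series[of g 0 r] holomorphic_on_subset[OF holo]) auto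
    then have "(\<lambda>n. Re ((deriv ^^ n) g 0 / fact n * complex_of_real (x ^ n))) sums Re (complex_of_real (F x))"
      unfolding F[OF x] by (intro sums_Re) simp
    then show ?thesis
      unfolding a_def times_complex.sel Re_complex_of_real Im_complex_of_real by simp
  qed
  ultimately show ?thesis
    using that by blast
qed

text \<open>For a measure not concentrated at \<open>0\<close> all moments are positive, and \<open>\<Sum>j. a j * s k ^ j\<close> is the
  moment of a mixture of multiplicative convolution powers. A measure concentrated at \<open>0\<close> has moments
  \<open>c, 0, 0, \<dots>\<close>, where the value of \<open>F\<close> at \<open>0\<close> enters; the transformed sequence
  \<open>F c, F 0, F 0, \<dots>\<close> comes from masses \<open>F c - F 0\<close> at \<open>0\<close> and \<open>F 0\<close> at \<open>1\<close>, and
  \<open>0 \<le> F 0 \<le> L\<close> makes both masses nonnegative.\<close>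

lemma power_series_preserves_unit_moment_seqs:
  assumes a: "\<And>j. 0 \<le> a j" and F: "\<And>x. 0 < x \<Longrightarrow> ereal x < \<rho> \<Longrightarrow> (\<lambda>j. a j * x ^ j) sums F x"
    and L: "(F \<longlongrightarrow> L) (at_right 0)" "0 \<le> F 0" "F 0 \<le> L"
  shows "entrywise_sends F (moment_seqs_lt \<rho> {0..1}) (moment_seqs {0..1})"
  unfolding entrywise_sends_def
proof
  fix s assume "s \<in> moment_seqs_lt \<rho> {0..1}"
  then have s: "s \<in> moment_seqs {0..1}" "\<And>k. ereal (s k) < \<rho>"
    by (auto simp: moment_seqs_lt_def)
  have s_nonneg: "0 \<le> s k" for k
    using s(1) unfolding moment_seqs_unit_iff by blast
  show "(\<lambda>k. F (s k)) \<in> moment_seqs {0..1}"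
  proof (cases "\<exists>k. s k = 0")
    case True
    have F0_le: "F 0 \<le> F (s 0)"
    proof (cases "s 0 = 0")
      case False
      with s_nonneg[of 0] have "0 < s 0" by simp
      have "\<forall>\<^sub>F x in at_right 0. 0 < x \<and> x < s 0"
        using \<open>0 < s 0\<close> by (intro eventually_conj eventually_at_right_less order_tendstoD[OF tendsto_ident_at]) auto
      then have "\<forall>\<^sub>F x in at_right 0. F x \<le> F (s 0)"
      proof eventually_elim
        case (elim x)
        then have "ereal x < \<rho>"
          using s(2)[of 0] by (meson ereal_less_eq(3) le_less_trans less_imp_le)
        with elim show ?case
          by (intro sums_le[OF _ F F[OF \<open>0 < s 0\<close> s(2)]] mult_left_mono power_mono a) auto
      qed
      then have "L \<le> F (s 0)"
        by (intro tendsto_upperbound[OF L(1)]) auto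
      with L show ?thesis by simp
    qed simp
    have "(\<lambda>k. \<Sum>z\<in>{0, 1::real}. (if z = 0 then F (s 0) - F 0 else F 0) * z ^ k) \<in> moment_seqs {0..1}"
      by (rule subsetD[OF moment_seqs_mono finite_atomic_moment_seq]) (use F0_le L in auto)
    also have "(\<lambda>k. \<Sum>z\<in>{0, 1::real}. (if z = 0 then F (s 0) - F 0 else F 0) * z ^ k) = (\<lambda>k. F (s k))"
    proof
      fix k
      show "(\<Sum>z\<in>{0, 1::real}. (if z = 0 then F (s 0) - F 0 else F 0) * z ^ k) = F (s k)"
        using True moment_seqs_unit_vanish[OF s(1)] by (cases k) auto
    qed
    finally show ?thesis .
  next
    case False
    with s_nonneg have pos: "0 < s k" for k
      by (metis less_le)
    define t where "t = (\<lambda>k. 1 / s 0 * s k)"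
    have "t \<in> moment_seqs {0..1}"
      unfolding t_def using s_nonneg by (intro moment_seqs_unit_cmult s) simp
    then have "(\<lambda>k. t k ^ j) \<in> moment_seqs {0..1}" for j
      by (rule moment_seqs_unit_power)
    then show ?thesis
    proof (rule moment_seqs_unit_mixture[where w = "\<lambda>j. a j * s 0 ^ j"])
      fix k
      have "a j * s 0 ^ j * t k ^ j = a j * s k ^ j" for j
        using pos[of 0] by (simp add: t_def power_divide)
      then show "(\<lambda>j. a j * s 0 ^ j * t k ^ j) sums F (s k)"
        by (simp only: F[OF pos s(2)])
    qed (use a pos[of 0] s_nonneg[of 0] in \<open>auto simp: t_def\<close>)
  qed
qed

section \<open>Characterisation of the transforms\<close>

text \<open>For \<open>b \<le> a\<close>, the mass \<open>a\<close> placed at \<open>sqrt (b / a)\<close> has the first three moments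
  \<open>a, sqrt (a * b), b\<close>; the Cauchy-Schwarz inequality for the representing measure of the transformed
  sequence is the claim.\<close>

lemma transform_log_convex:
  assumes send: "entrywise_sends F (moment_seqs_lt \<rho> {0..1}) (moment_seqs {0..1})" and "0 < \<rho>"
    and ab: "0 \<le> a" "ereal a < \<rho>" "0 \<le> b" "ereal b < \<rho>"
  shows "(F (sqrt (a * b)))\<^sup>2 \<le> F a * F b"
  using ab
proof (induction a b rule: linorder_wlog)
  case (sym a b)
  then show ?case by (simp add: mult.commute)
next
  case (le b a)
  show ?case
  proof (cases "a = 0")
    case True
    then show ?thesis
      using le by (simp add: power2_eq_square)
  next
    case False
    define t where "t = sqrt (b / a)"
    have t: "0 \<le> t" "t \<le> 1" "a * t\<^sup>2 = b" "a * t = sqrt (b * a)"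
      using le False by (auto simp: t_def real_sqrt_mult real_sqrt_divide field_simps)
    \<comment> \<open>A second atom of mass \<open>0\<close>, to use the two-atom construction.\<close>
    obtain y where y: "y \<in> {0, 1}" "y \<noteq> t"
      by (metis insertI1 insertI2 zero_neq_one)
    have "(\<lambda>k. a * t ^ k + 0 * y ^ k) \<in> moment_seqs_lt \<rho> {t, y}"
      using le t y \<open>0 < \<rho>\<close> by (intro two_atom_moment_seq_lt) auto
    then have "(\<lambda>k. a * t ^ k) \<in> moment_seqs_lt \<rho> {0..1}"
      using moment_seqs_lt_mono[of "{t, y}" "{0..1}" \<rho>] t y by auto
    then have "(\<lambda>k. F (a * t ^ k)) \<in> moment_seqs {0..1}"
      using send by (simp add: entrywise_sends_def)
    then have "(\<lambda>k. F (a * t ^ k)) \<in> moment_seqs UNIV"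
      using moment_seqs_mono[of "{0..1}" UNIV] by auto
    from moment_seqs_Cauchy_Schwarz[OF this] show ?thesis
      using t by (simp add: mult.commute)
  qed
qed

theorem theorem4p1:
  fixes \<rho> :: ereal and u0 :: real and F :: "real \<Rightarrow> real"
  assumes "0 < \<rho>" and "0 < u0" and "u0 < 1"
  defines "P1a \<equiv> entrywise_sends F
      (moment_seqs_lt \<rho> {1, u0} \<union> moment_seqs_lt \<rho> {0, 1}) (moment_seqs UNIV)"
    and "P1b \<equiv> (\<forall>a b. 0 \<le> a \<and> ereal a < \<rho> \<and> 0 \<le> b \<and> ereal b < \<rho> \<longrightarrow>
      F a * F b \<ge> (F (sqrt (a * b)))\<^sup>2)"
    and "P2 \<equiv> entrywise_sends F (moment_seqs_lt \<rho> {0..1}) (moment_seqs {0..1})"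
    and "P3 \<equiv> (\<exists>g. abs_monotonic_entire \<rho> g \<and>
        (\<forall>x. 0 < x \<and> ereal x < \<rho> \<longrightarrow> complex_of_real (F x) = g (complex_of_real x))) \<and>
      (\<exists>L. (F \<longlongrightarrow> L) (at_right 0) \<and> 0 \<le> F 0 \<and> F 0 \<le> L)"
  shows "((P1a \<and> P1b) \<longleftrightarrow> P2) \<and> (P2 \<longleftrightarrow> P3) \<and>
    (continuous_on {x. 0 < x \<and> ereal x < \<rho>} F \<longrightarrow> (P1a \<longleftrightarrow> P2) \<and> (P1a \<longleftrightarrow> P3))"
proof -
  have P1a_sends: "entrywise_sends F (moment_seqs_lt \<rho> {1, u0}) (moment_seqs UNIV)"
    "entrywise_sends F (moment_seqs_lt \<rho> {0, 1}) (moment_seqs UNIV)" if P1a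
    using that unfolding P1a_def by (auto intro: entrywise_sends_mono)
  have P1a_mono: "0 \<le> F x" "F x \<le> F y" if P1a "0 \<le> x" "x \<le> y" "ereal y < \<rho>" for x y
    using transform_nonneg_mono[OF P1a_sends(2)[OF that(1)] \<open>0 < \<rho>\<close> that(2-4)] .
  have P1_cont: "continuous_on {x. 0 < x \<and> ereal x < \<rho>} F" if P1a P1b
    using P1a_mono(1)[OF \<open>P1a\<close> _ order_refl] P1a_mono(2)[OF \<open>P1a\<close>] \<open>P1b\<close>
    by (intro mono_log_convex_continuous) (simp_all add: P1b_def)
  have P1a_P3: P3 if P1a and cont: "continuous_on {x. 0 < x \<and> ereal x < \<rho>} F"
  proof -
    obtain d where d: "0 < d" "ereal d < \<rho>"
      using ereal_dense2[OF \<open>0 < \<rho>\<close>] by auto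
    have below: "ereal x < \<rho>" if "x \<le> d" for x
      using that d by (meson ereal_less_eq(3) le_less_trans)
    obtain L where L: "(F \<longlongrightarrow> L) (at_right 0)" "F 0 \<le> L"
      using mono_right_limit[OF d(1), of "F 0" F] P1a_mono(2)[OF \<open>P1a\<close>] below by auto
    obtain g where "abs_monotonic_entire \<rho> g"
      "\<And>x. 0 < x \<Longrightarrow> ereal x < \<rho> \<Longrightarrow> complex_of_real (F x) = g (complex_of_real x)"
    proof (rule absolutely_monotonic_of_test_inequalities[OF assms(1-3) cont L(1)])
      fix p :: "real poly" and a b :: real assume *: "\<And>x. 0 \<le> poly p x" "0 \<le> a" "0 < b" "ereal (a + b) < \<rho>"
      have "0 \<le> (\<Sum>k\<le>degree p. coeff p k * F (a * 1 ^ k + b * u0 ^ k))"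
        using assms(1-3) * by (intro transform_test_polynomial[OF P1a_sends(1)[OF \<open>P1a\<close>]]) auto
      then show "0 \<le> (\<Sum>k\<le>degree p. coeff p k * F (a + b * u0 ^ k))"
        by simp
    qed blast
    moreover have "0 \<le> F 0"
      using P1a_mono(1)[OF \<open>P1a\<close>, of 0 0] \<open>0 < \<rho>\<close> by (simp add: zero_ereal_def)
    ultimately show P3
      unfolding P3_def using L by blast
  qed
  have P3_P2: P2 if P3
  proof -
    obtain g L where "abs_monotonic_entire \<rho> g"
      "\<And>x. 0 < x \<Longrightarrow> ereal x < \<rho> \<Longrightarrow> complex_of_real (F x) = g (complex_of_real x)"
      and L: "(F \<longlongrightarrow> L) (at_right 0)" "0 \<le> F 0" "F 0 \<le> L"
      using \<open>P3\<close> unfolding P3_def by blast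
    from abs_monotonic_entire_power_series[OF this(1) \<open>0 < \<rho>\<close> this(2)]
    show P2
      unfolding P2_def using power_series_preserves_unit_moment_seqs[OF _ _ L] by metis
  qed
  have P2_P1a: P1a if P2
    unfolding P1a_def
  proof (rule entrywise_sends_mono)
    show "entrywise_sends F (moment_seqs_lt \<rho> {0..1}) (moment_seqs {0..1})"
      using that by (simp add: P2_def)
    show "moment_seqs_lt \<rho> {1, u0} \<union> moment_seqs_lt \<rho> {0, 1} \<subseteq> moment_seqs_lt \<rho> {0..1}"
      using assms(2,3) by (intro Un_least moment_seqs_lt_mono) auto
  qed (simp add: moment_seqs_mono)
  have P2_P1b: P1b if P2
    using transform_log_convex[OF that[unfolded P2_def] \<open>0 < \<rho>\<close>] by (simp add: P1b_def)
  show ?thesis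
    using P1_cont P1a_P3 P3_P2 P2_P1a P2_P1b by blast
qed

end
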